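(* Let $p\in[1,\infty]$ and let $L(\mathbb{R})$ be the set of Lebesgue integrable real functions on $\mathbb{R}$, with functions equal almost everywhere identified. Define $d_N^p:L(\mathbb{R})\times L(\mathbb{R})\to\mathbb{R}$ by $$d_N^p(f,g)=\frac{d^p(f,g)}{\int\max(|f|,|g|,|f-g|)\,dx},\qquad d^p(f,g)=\Big(\big(\int (f-g)^+\,dx\big)^p+\big(\int (f-g)^-\,dx\big)^p\Big)^{1/p}$$ (for $p=\infty$, $d^\infty(f,g)$ is the maximum of the two integrals), with the convention $0/0:=0$. Then $(L(\mathbb{R}),d_N^p)$ is a metric space. In addition, $d_N^p$ takes values in $[0,1]$.
   Context: For a real function $f$, $f^+=\max(f,0)$ and $f^-=\max(-f,0)$. Integrals are over $\mathbb{R}$ with respect to Lebesgue measure. *)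

theory Defs
  imports "HOL-Analysis.Analysis"
begin

definition pos_part :: "(real \<Rightarrow> real) \<Rightarrow> real \<Rightarrow> real" where
  "pos_part f = (\<lambda>x. max (f x) 0)"

definition neg_part :: "(real \<Rightarrow> real) \<Rightarrow> real \<Rightarrow> real" where
  "neg_part f = (\<lambda>x. max (- f x) 0)"

definition dist_p :: "ereal \<Rightarrow> (real \<Rightarrow> real) \<Rightarrow> (real \<Rightarrow> real) \<Rightarrow> real" where
  "dist_p p f g =
    (let a = (LINT x|lebesgue. pos_part (\<lambda>y. f y - g y) x);
         b = (LINT x|lebesgue. neg_part (\<lambda>y. f y - g y) x)
     in if p = \<infinity> then max a b
        else (a powr real_of_ereal p + b powr real_of_ereal p) powr (1 / real_of_ereal p))"

text \<open>The convention \<open>0 / 0 = 0\<close> is the one built into division on the reals.\<close>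

definition dist_N :: "ereal \<Rightarrow> (real \<Rightarrow> real) \<Rightarrow> (real \<Rightarrow> real) \<Rightarrow> real" where
  "dist_N p f g =
    dist_p p f g / (LINT x|lebesgue. max (max \<bar>f x\<bar> \<bar>g x\<bar>) \<bar>f x - g x\<bar>)"

definition ae_eq :: "(real \<Rightarrow> real) \<Rightarrow> (real \<Rightarrow> real) \<Rightarrow> bool" where
  "ae_eq f g \<longleftrightarrow>
    integrable lebesgue f \<and> integrable lebesgue g \<and> (AE x in lebesgue. f x = g x)"

text \<open>The relation is reflexive only on the integrable functions, so the elements of the
  (partial) quotient type are exactly the almost-everywhere classes of integrable functions.\<close>

quotient_type L_space = "real \<Rightarrow> real" / partial: ae_eq
proof (rule part_equivpI)
  show "\<exists>f. ae_eq f f"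
    by (rule exI[of _ "\<lambda>_. 0"]) (simp add: ae_eq_def)
  show "symp ae_eq"
    by (rule sympI) (auto simp: ae_eq_def elim: eventually_mono)
  show "transp ae_eq"
    by (rule transpI) (auto simp: ae_eq_def elim: eventually_elim2)
qed

lemma dist_N_cong:
  assumes "ae_eq f f'" and "ae_eq g g'"
  shows "dist_N p f g = dist_N p f' g'"
proof -
  have meas [measurable]:
    "f \<in> borel_measurable lebesgue" "f' \<in> borel_measurable lebesgue"
    "g \<in> borel_measurable lebesgue" "g' \<in> borel_measurable lebesgue"
    using assms by (auto simp: ae_eq_def)
  have eq: "AE x in lebesgue. f x = f' x \<and> g x = g' x"
    using assms by (auto simp: ae_eq_def)
  have pos: "(LINT x|lebesgue. pos_part (\<lambda>y. f y - g y) x) =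
      (LINT x|lebesgue. pos_part (\<lambda>y. f' y - g' y) x)"
    unfolding pos_part_def using eq by (intro integral_cong_AE) auto
  have neg: "(LINT x|lebesgue. neg_part (\<lambda>y. f y - g y) x) =
      (LINT x|lebesgue. neg_part (\<lambda>y. f' y - g' y) x)"
    unfolding neg_part_def using eq by (intro integral_cong_AE) auto
  have den: "(LINT x|lebesgue. max (max \<bar>f x\<bar> \<bar>g x\<bar>) \<bar>f x - g x\<bar>) =
      (LINT x|lebesgue. max (max \<bar>f' x\<bar> \<bar>g' x\<bar>) \<bar>f' x - g' x\<bar>)"
    using eq by (intro integral_cong_AE) auto
  show ?thesis
    unfolding dist_N_def dist_p_def pos neg den ..
qed

lift_definition L_dist_N :: "ereal \<Rightarrow> L_space \<Rightarrow> L_space \<Rightarrow> real" is dist_N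
  by (rule dist_N_cong)

end

theory Submission
  imports Defs
begin

text \<open>Pointwise \<open>max (max \<bar>u\<bar> \<bar>v\<bar>) \<bar>u - v\<bar> = (\<bar>u\<bar> + \<bar>v\<bar> + \<bar>u - v\<bar>) / 2\<close>, so the denominator is
  \<open>(\<parallel>f\<parallel> + \<parallel>g\<parallel> + \<parallel>f - g\<parallel>) / 2\<close> in terms of the \<open>L\<^sup>1\<close> norm, while the numerator is the \<open>\<ell>\<^sup>p\<close> norm
  of the vector \<open>v(f, g)\<close> of the integrals of \<open>(f - g)\<^sup>+\<close> and \<open>(f - g)\<^sup>-\<close>, whose coordinates have
  difference \<open>\<integral>f - \<integral>g\<close> and sum \<open>\<parallel>f - g\<parallel>\<close>.  Hence \<open>v(f, h) + v(h, g) = v(f, g) + (t, t)\<close> with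
  \<open>t \<ge> 0\<close>, and by monotonicity of the \<open>\<ell>\<^sup>p\<close> norm this sum has norm at least
  \<open>(1 + t / \<parallel>f - g\<parallel>)\<close> times that of \<open>v(f, g)\<close>.  Since \<open>\<parallel>f - g\<parallel> \<le> \<parallel>f\<parallel> + \<parallel>g\<parallel>\<close>, the distance from \<open>f\<close> to
  \<open>g\<close> does not decrease when its numerator is replaced by \<open>d\<^sup>p(f, h) + d\<^sup>p(h, g)\<close> and its
  denominator by \<open>(\<parallel>f\<parallel> + \<parallel>g\<parallel> + \<parallel>f - h\<parallel> + \<parallel>h - g\<parallel>) / 2\<close>, which dominates the denominators
  of both \<open>(f, h)\<close> and \<open>(h, g)\<close>.\<close>

section \<open>The l^p norm of nonnegative pairs\<close>

definition pnorm2 :: "ereal \<Rightarrow> real \<Rightarrow> real \<Rightarrow> real" where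
  "pnorm2 p a b = (if p = \<infinity> then max a b
     else (a powr real_of_ereal p + b powr real_of_ereal p) powr (1 / real_of_ereal p))"

lemma real_of_ereal_ge_1: "1 \<le> p \<Longrightarrow> p \<noteq> \<infinity> \<Longrightarrow> 1 \<le> real_of_ereal p"
  by (cases p) auto

lemma pnorm2_nonneg: "0 \<le> a \<Longrightarrow> 0 \<le> pnorm2 p a b"
  by (auto simp: pnorm2_def)

lemma pnorm2_commute: "pnorm2 p a b = pnorm2 p b a"
  by (simp add: pnorm2_def max.commute add.commute)

lemma pnorm2_mono:
  assumes "1 \<le> p" "0 \<le> a" "0 \<le> b" "a \<le> a'" "b \<le> b'"
  shows "pnorm2 p a b \<le> pnorm2 p a' b'"
  using assms real_of_ereal_ge_1[of p]
  by (auto simp: pnorm2_def intro!: powr_mono2 add_mono add_nonneg_nonneg)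

lemma pnorm2_scale:
  assumes "1 \<le> p" "0 \<le> a" "0 \<le> b" "0 \<le> c"
  shows "pnorm2 p (c * a) (c * b) = c * pnorm2 p a b"
proof (cases "p = \<infinity>")
  case True
  with assms show ?thesis by (simp add: pnorm2_def max_mult_distrib_left)
next
  case False
  define r where "r = real_of_ereal p"
  have r: "1 \<le> r" using real_of_ereal_ge_1 assms False by (simp add: r_def)
  have "(c * a) powr r + (c * b) powr r = c powr r * (a powr r + b powr r)"
    using assms by (simp add: powr_mult algebra_simps)
  then have "((c * a) powr r + (c * b) powr r) powr (1 / r)
      = (c powr r) powr (1 / r) * (a powr r + b powr r) powr (1 / r)"
    using assms by (simp add: powr_mult)
  then show ?thesis
    using assms r False by (simp add: pnorm2_def powr_powr flip: r_def)
qed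

lemma pnorm2_0_right: "1 \<le> p \<Longrightarrow> 0 \<le> a \<Longrightarrow> pnorm2 p a 0 = a"
  using real_of_ereal_ge_1[of p] by (auto simp: pnorm2_def powr_powr)

lemma pnorm2_eq_0_iff:
  assumes "1 \<le> p" "0 \<le> a" "0 \<le> b"
  shows "pnorm2 p a b = 0 \<longleftrightarrow> a = 0 \<and> b = 0"
proof
  assume z: "pnorm2 p a b = 0"
  have "a \<le> pnorm2 p a b" "b \<le> pnorm2 p a b"
    using pnorm2_mono[of p a 0 a b] pnorm2_mono[of p b 0 b a] assms
    by (simp_all add: pnorm2_0_right pnorm2_commute[of p b a])
  with z assms show "a = 0 \<and> b = 0" by simp
qed (use assms in \<open>simp add: pnorm2_0_right\<close>)

text \<open>Convexity on the open half-line extends to 0: if an endpoint is 0, the claim reduces to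
  \<open>t powr r \<le> t\<close> for \<open>0 < t < 1\<close>.\<close>

lemma convex_powr_nonneg:
  fixes r :: real
  assumes "1 \<le> r"
  shows "convex_on {0..} (\<lambda>x. x powr r)"
proof (intro convex_onI)
  fix t x y :: real
  assume t: "0 < t" "t < 1" and xy: "x \<in> {0..}" "y \<in> {0..}"
  have le: "t powr r * z \<le> t * z" if "0 < t" "t < 1" "0 \<le> z" for t z :: real
    using that assms powr_mono'[of 1 r t] by (intro mult_right_mono) auto
  show "((1 - t) *\<^sub>R x + t *\<^sub>R y) powr r \<le> (1 - t) * x powr r + t * y powr r"
  proof (cases "x = 0 \<or> y = 0")
    case True
    then show ?thesis
      using t xy le[of t "y powr r"] le[of "1 - t" "x powr r"] by (auto simp: powr_mult)
  next
    case False
    from convex_onD[OF powr_convex[OF assms], of t x y] False t xy show ?thesis by auto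
  qed
qed simp

text \<open>Minkowski's inequality by convexity: the sum divided by \<open>s + t\<close> is the
  convex combination of the two normalized vectors with weights \<open>s / (s + t)\<close> and
  \<open>t / (s + t)\<close>.\<close>

lemma pnorm2_triangle:
  assumes p: "1 \<le> p" and nn: "0 \<le> a" "0 \<le> b" "0 \<le> c" "0 \<le> d"
  shows "pnorm2 p (a + c) (b + d) \<le> pnorm2 p a b + pnorm2 p c d"
proof (cases "p = \<infinity>")
  case True
  then show ?thesis by (auto simp: pnorm2_def)
next
  case False
  define r where "r = real_of_ereal p"
  have r: "1 \<le> r" using real_of_ereal_ge_1 p False by (simp add: r_def)
  define s t where "s = pnorm2 p a b" and "t = pnorm2 p c d"
  have st: "0 \<le> s" "0 \<le> t" using nn by (simp_all add: s_def t_def pnorm2_nonneg)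
  show ?thesis
  proof (cases "s = 0 \<or> t = 0")
    case True
    then show ?thesis using p nn st pnorm2_eq_0_iff[of p a b] pnorm2_eq_0_iff[of p c d]
      by (auto simp: s_def t_def)
  next
    case False
    with st have pos: "0 < s" "0 < t" by auto
    define l where "l = t / (s + t)"
    have l: "0 \<le> l" "l \<le> 1" "1 - l = s / (s + t)" using pos by (auto simp: l_def field_simps)
    have conv: "((x + y) / (s + t)) powr r \<le> (1 - l) * (x / s) powr r + l * (y / t) powr r"
      if "0 \<le> x" "0 \<le> y" for x y
    proof -
      have "(x + y) / (s + t) = (1 - l) * (x / s) + l * (y / t)"
        unfolding l(3) using pos by (simp add: l_def add_divide_distrib)
      then show ?thesis
        using convex_onD[OF convex_powr_nonneg[OF r] l(1,2), of "x / s" "y / t"] that pos by simp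
    qed
    have unit: "(x / pnorm2 p x y) powr r + (y / pnorm2 p x y) powr r = 1"
      if "0 \<le> x" "0 \<le> y" "0 < pnorm2 p x y" for x y
    proof -
      have "pnorm2 p x y powr r = x powr r + y powr r"
        using \<open>p \<noteq> \<infinity>\<close> r by (simp add: pnorm2_def powr_powr flip: r_def)
      moreover have "pnorm2 p x y powr r > 0" using that by simp
      ultimately show ?thesis
        using that by (simp add: powr_divide flip: add_divide_distrib)
    qed
    have "((a + c) / (s + t)) powr r + ((b + d) / (s + t)) powr r
        \<le> (1 - l) * ((a / s) powr r + (b / s) powr r) + l * ((c / t) powr r + (d / t) powr r)"
      using conv[of a c] conv[of b d] nn by (simp add: algebra_simps)
    also have "\<dots> = 1"
      using unit[of a b] unit[of c d] nn pos by (simp add: s_def t_def)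
    finally have "pnorm2 p ((a + c) / (s + t)) ((b + d) / (s + t)) \<le> 1"
      using \<open>p \<noteq> \<infinity>\<close> r by (auto simp: pnorm2_def simp flip: r_def intro!: powr_le1)
    moreover have "pnorm2 p (a + c) (b + d)
        = (s + t) * pnorm2 p ((a + c) / (s + t)) ((b + d) / (s + t))"
      using pnorm2_scale[of p "(a + c) / (s + t)" "(b + d) / (s + t)" "s + t"] p nn pos by simp
    ultimately have "pnorm2 p (a + c) (b + d) \<le> (s + t) * 1"
      using pos by (metis add_pos_pos less_imp_le mult_left_mono)
    then show ?thesis by (simp add: s_def t_def)
  qed
qed

text \<open>Split the vector into its two axis components.\<close>

lemma pnorm2_le_sum:
  assumes "1 \<le> p" "0 \<le> a" "0 \<le> b"
  shows "pnorm2 p a b \<le> a + b"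
  using pnorm2_triangle[of p a 0 0 b] assms
  by (simp add: pnorm2_0_right pnorm2_commute[of p 0])

lemma pnorm2_add_const:
  assumes p: "1 \<le> p" and nn: "0 \<le> a" "0 \<le> b" "0 \<le> t"
  shows "pnorm2 p a b * (a + b + t) \<le> pnorm2 p (a + t) (b + t) * (a + b)"
proof (cases "a + b = 0")
  case True
  then have "a = 0" "b = 0" using nn by auto
  then show ?thesis using p by (simp add: pnorm2_0_right)
next
  case False
  \<comment> \<open>Scaling by \<open>c\<close> adds only the shares \<open>t * a / (a + b)\<close>
    and \<open>t * b / (a + b)\<close>, each at most \<open>t\<close>, to the coordinates.\<close>
  define c where "c = 1 + t / (a + b)"
  have "c * a \<le> a + t" "c * b \<le> b + t"
    using False nn by (auto simp: c_def field_simps)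
  then have "pnorm2 p (c * a) (c * b) \<le> pnorm2 p (a + t) (b + t)"
    using nn p by (intro pnorm2_mono) (auto simp: c_def)
  then have "c * pnorm2 p a b \<le> pnorm2 p (a + t) (b + t)"
    using nn p by (subst (asm) pnorm2_scale) (auto simp: c_def)
  then have "c * pnorm2 p a b * (a + b) \<le> pnorm2 p (a + t) (b + t) * (a + b)"
    using nn by (intro mult_right_mono) auto
  moreover have "c * (a + b) = a + b + t" using False by (simp add: c_def field_simps)
  ultimately show ?thesis by (metis mult.assoc mult.commute)
qed

section \<open>The triangle inequality for the normalized quotient\<close>

text \<open>\<open>F\<close>, \<open>G\<close>, \<open>H\<close> stand for the norms of f, g, h, and
  the three pairs for the vectors of (f, g), (f, h), (h, g).\<close>

lemma normalized_triangle:
  assumes p: "1 \<le> p"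
    and nn: "0 \<le> a" "0 \<le> b" "0 \<le> a1" "0 \<le> b1" "0 \<le> a2" "0 \<le> b2"
    and t: "0 \<le> t" "a1 + a2 = a + t" "b1 + b2 = b + t"
    and F: "0 \<le> F" "0 \<le> G" "0 \<le> H" "a + b \<le> F + G" "H \<le> F + (a1 + b1)" "H \<le> G + (a2 + b2)"
  shows "pnorm2 p a b / ((F + G + (a + b)) / 2) \<le>
    pnorm2 p a1 b1 / ((F + H + (a1 + b1)) / 2) + pnorm2 p a2 b2 / ((H + G + (a2 + b2)) / 2)"
proof -
  define E where "E = (F + G + (a + b)) / 2 + t"
  have E: "E = (F + G + (a1 + b1) + (a2 + b2)) / 2" unfolding E_def using t by argo
  define n n1 n2 where n: "n = pnorm2 p a b" "n1 = pnorm2 p a1 b1" "n2 = pnorm2 p a2 b2"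
  have n0: "0 \<le> n" "0 \<le> n1" "0 \<le> n2" using nn by (auto simp: n pnorm2_nonneg)
  \<comment> \<open>If \<open>D = 0\<close>, then \<open>x + y \<le> 2 * D\<close> makes the
    numerator vanish as well, so the convention 0/0 = 0 does no harm.\<close>
  have mono: "pnorm2 p x y / E \<le> pnorm2 p x y / D"
    if "0 \<le> x" "0 \<le> y" "x + y \<le> 2 * D" "D \<le> E" for x y D
  proof (cases "D = 0")
    case True
    with that have "x = 0" "y = 0" by auto
    with p show ?thesis by (simp add: pnorm2_0_right)
  next
    case False
    with that show ?thesis by (intro divide_left_mono) (auto simp: pnorm2_nonneg)
  qed
  have "n * (a + b + t) \<le> pnorm2 p (a1 + a2) (b1 + b2) * (a + b)"
    using pnorm2_add_const[OF p nn(1,2) t(1)] t by (simp add: n)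
  also have "\<dots> \<le> (n1 + n2) * (a + b)"
    using pnorm2_triangle[OF p nn(3-6)] nn by (intro mult_right_mono) (auto simp: n)
  finally have 1: "n * (a + b + t) \<le> (n1 + n2) * (a + b)" .
  have 2: "n \<le> n1 + n2"
  proof -
    have "n \<le> pnorm2 p (a1 + a2) (b1 + b2)" unfolding n using p nn t by (intro pnorm2_mono) auto
    also have "\<dots> \<le> n1 + n2" using pnorm2_triangle[OF p nn(3-6)] by (simp add: n)
    finally show ?thesis .
  qed
  have "n / ((F + G + (a + b)) / 2) \<le> (n1 + n2) / E"
  proof (cases "F + G + (a + b) = 0")
    case True
    then show ?thesis using n0 nn t F by (simp add: E_def)
  next
    case False
    \<comment> \<open>The first summand is controlled by the shift estimate \<open>1\<close>, the
      second by \<open>2\<close>, as its factor is nonnegative by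
      \<open>a + b \<le> F + G\<close>.\<close>
    have "n * E = n * (a + b + t) + n * ((F + G - (a + b)) / 2)"
      by (simp add: E_def algebra_simps add_divide_distrib diff_divide_distrib)
    also have "\<dots> \<le> (n1 + n2) * (a + b) + (n1 + n2) * ((F + G - (a + b)) / 2)"
      using F by (intro add_mono 1 mult_right_mono 2) auto
    also have "\<dots> = (n1 + n2) * ((F + G + (a + b)) / 2)"
      by (simp add: algebra_simps add_divide_distrib diff_divide_distrib)
    finally have "n * E \<le> (n1 + n2) * ((F + G + (a + b)) / 2)" .
    moreover have "0 < (F + G + (a + b)) / 2" using False F nn by (simp add: less_le)
    moreover from this have "0 < E" unfolding E_def using t by (intro add_pos_nonneg)
    ultimately show ?thesis by (simp only: pos_divide_le_eq pos_le_divide_eq times_divide_eq_left)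
  qed
  also have "\<dots> \<le> n1 / ((F + H + (a1 + b1)) / 2) + n2 / ((H + G + (a2 + b2)) / 2)"
    unfolding add_divide_distrib n using nn F by (intro add_mono mono) (auto simp: E)
  finally show ?thesis by (simp add: n)
qed

section \<open>Integrals of positive parts and L1 norms\<close>

abbreviation L1_norm :: "(real \<Rightarrow> real) \<Rightarrow> real" where
  "L1_norm f \<equiv> LINT x|lebesgue. \<bar>f x\<bar>"

abbreviation excess :: "(real \<Rightarrow> real) \<Rightarrow> (real \<Rightarrow> real) \<Rightarrow> real" where
  "excess f g \<equiv> LINT x|lebesgue. max (f x - g x) 0"

lemma excess_nonneg: "0 \<le> excess f g"
  by (rule Bochner_Integration.integral_nonneg) simp

lemma L1_norm_nonneg: "0 \<le> L1_norm f"
  by (rule Bochner_Integration.integral_nonneg) simp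

lemma excess_add:
  assumes "integrable lebesgue f" "integrable lebesgue g"
  shows "excess f g + excess g f = L1_norm (\<lambda>x. f x - g x)"
proof -
  have "excess f g + excess g f = (LINT x|lebesgue. max (f x - g x) 0 + max (g x - f x) 0)"
    using assms by (intro Bochner_Integration.integral_add[symmetric]) auto
  also have "\<dots> = L1_norm (\<lambda>x. f x - g x)"
    by (intro Bochner_Integration.integral_cong) auto
  finally show ?thesis .
qed

lemma excess_diff:
  assumes "integrable lebesgue f" "integrable lebesgue g"
  shows "excess f g - excess g f = integral\<^sup>L lebesgue f - integral\<^sup>L lebesgue g"
proof -
  have "excess f g - excess g f = (LINT x|lebesgue. max (f x - g x) 0 - max (g x - f x) 0)"
    using assms by (intro Bochner_Integration.integral_diff[symmetric]) auto
  also have "\<dots> = (LINT x|lebesgue. f x - g x)"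
    by (intro Bochner_Integration.integral_cong) auto
  also have "\<dots> = integral\<^sup>L lebesgue f - integral\<^sup>L lebesgue g"
    using assms by (rule Bochner_Integration.integral_diff)
  finally show ?thesis .
qed

lemma dist_N_eq:
  assumes "integrable lebesgue f" "integrable lebesgue g"
  shows "dist_N p f g = pnorm2 p (excess f g) (excess g f) /
    ((L1_norm f + L1_norm g + (excess f g + excess g f)) / 2)"
proof -
  have "(LINT x|lebesgue. max (max \<bar>f x\<bar> \<bar>g x\<bar>) \<bar>f x - g x\<bar>)
      = (LINT x|lebesgue. (\<bar>f x\<bar> + \<bar>g x\<bar> + \<bar>f x - g x\<bar>) / 2)"
    by (intro Bochner_Integration.integral_cong) (auto simp: max_def abs_if)
  also have "\<dots> = (L1_norm f + L1_norm g + (excess f g + excess g f)) / 2"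
    using assms by (simp add: excess_add)
  finally have denominator: "(LINT x|lebesgue. max (max \<bar>f x\<bar> \<bar>g x\<bar>) \<bar>f x - g x\<bar>) =
    (L1_norm f + L1_norm g + (excess f g + excess g f)) / 2" .
  show ?thesis
    unfolding dist_N_def denominator
    by (simp add: dist_p_def pnorm2_def pos_part_def neg_part_def Let_def)
qed

lemma L1_norm_diff_triangle:
  assumes "integrable lebesgue f" "integrable lebesgue g" "integrable lebesgue h"
  shows "L1_norm (\<lambda>x. f x - g x) \<le> L1_norm (\<lambda>x. f x - h x) + L1_norm (\<lambda>x. h x - g x)"
proof -
  have "L1_norm (\<lambda>x. f x - g x) \<le> (LINT x|lebesgue. \<bar>f x - h x\<bar> + \<bar>h x - g x\<bar>)"
    using assms by (intro Bochner_Integration.integral_mono) auto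
  also have "\<dots> = L1_norm (\<lambda>x. f x - h x) + L1_norm (\<lambda>x. h x - g x)"
    using assms by (intro Bochner_Integration.integral_add) auto
  finally show ?thesis .
qed

lemma L1_norm_diff_le:
  assumes "integrable lebesgue f" "integrable lebesgue g"
  shows "L1_norm (\<lambda>x. f x - g x) \<le> L1_norm f + L1_norm g"
  using L1_norm_diff_triangle[of f g "\<lambda>_. 0"] assms by simp

lemma excess_eq_0_iff:
  assumes "integrable lebesgue f" "integrable lebesgue g"
  shows "excess f g = 0 \<and> excess g f = 0 \<longleftrightarrow> (AE x in lebesgue. f x = g x)"
proof -
  have "excess f g = 0 \<and> excess g f = 0 \<longleftrightarrow> L1_norm (\<lambda>x. f x - g x) = 0"
    using excess_add[OF assms] excess_nonneg[of f g] excess_nonneg[of g f] by linarith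
  also have "\<dots> \<longleftrightarrow> (AE x in lebesgue. f x = g x)"
    using assms by (subst integral_nonneg_eq_0_iff_AE) auto
  finally show ?thesis .
qed

section \<open>Metric properties of the normalized distance\<close>

lemma dist_N_nonneg: "integrable lebesgue f \<Longrightarrow> integrable lebesgue g \<Longrightarrow> 0 \<le> dist_N p f g"
  by (simp add: dist_N_eq pnorm2_nonneg excess_nonneg L1_norm_nonneg)

text \<open>The numerator is at most the norm of f - g, which is at most its average with the sum of
  the norms of f and g.\<close>

lemma dist_N_le_1:
  assumes "1 \<le> p" "integrable lebesgue f" "integrable lebesgue g"
  shows "dist_N p f g \<le> 1"
proof -
  have "pnorm2 p (excess f g) (excess g f) \<le> excess f g + excess g f"
    using assms by (intro pnorm2_le_sum excess_nonneg)
  moreover have "excess f g + excess g f \<le> L1_norm f + L1_norm g"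
    using assms by (simp add: excess_add L1_norm_diff_le)
  ultimately have "pnorm2 p (excess f g) (excess g f)
      \<le> (L1_norm f + L1_norm g + (excess f g + excess g f)) / 2"
    by argo
  moreover have "0 \<le> (L1_norm f + L1_norm g + (excess f g + excess g f)) / 2"
    by (simp add: excess_nonneg L1_norm_nonneg)
  ultimately show ?thesis
    unfolding dist_N_eq[OF assms(2,3)] divide_le_eq_1 by argo
qed

lemma dist_N_commute:
  "integrable lebesgue f \<Longrightarrow> integrable lebesgue g \<Longrightarrow> dist_N p f g = dist_N p g f"
  by (simp add: dist_N_eq pnorm2_commute[of p "excess f g"] add_ac)

text \<open>A zero denominator, being half a sum of nonnegative terms, forces both excesses to
  vanish, so 0/0 = 0 creates no spurious zeros.\<close>

lemma dist_N_eq_0_iff: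
  assumes "1 \<le> p" "integrable lebesgue f" "integrable lebesgue g"
  shows "dist_N p f g = 0 \<longleftrightarrow> (AE x in lebesgue. f x = g x)"
proof -
  have "dist_N p f g = 0 \<longleftrightarrow> excess f g = 0 \<and> excess g f = 0"
    using pnorm2_eq_0_iff[OF assms(1), of "excess f g" "excess g f"]
      excess_nonneg[of f g] excess_nonneg[of g f] L1_norm_nonneg[of f] L1_norm_nonneg[of g]
    unfolding dist_N_eq[OF assms(2,3)] divide_eq_0_iff by linarith
  then show ?thesis using assms by (simp add: excess_eq_0_iff)
qed

lemma dist_N_triangle:
  assumes p: "1 \<le> p"
    and f: "integrable lebesgue f" and g: "integrable lebesgue g" and h: "integrable lebesgue h"
  shows "dist_N p f g \<le> dist_N p f h + dist_N p h g"
  unfolding dist_N_eq[OF f g] dist_N_eq[OF f h] dist_N_eq[OF h g]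
\<comment> \<open>\<open>t\<close> is the slack in the triangle inequality for
  \<open>excess\<close>.\<close>
proof (rule normalized_triangle[where t = "excess f h + excess h g - excess f g", OF p])
  have "excess f g \<le> (LINT x|lebesgue. max (f x - h x) 0 + max (h x - g x) 0)"
    using f g h by (intro Bochner_Integration.integral_mono) auto
  also have "\<dots> = excess f h + excess h g"
    using f g h by (intro Bochner_Integration.integral_add) auto
  finally show "0 \<le> excess f h + excess h g - excess f g" by simp
  \<comment> \<open>The reversed excesses have the same slack, because the differences of integrals
    telescope.\<close>
  show "excess h f + excess g h = excess g f + (excess f h + excess h g - excess f g)"
    using excess_diff[OF f g] excess_diff[OF f h] excess_diff[OF h g] by linarith
  show "excess f g + excess g f \<le> L1_norm f + L1_norm g"
    using f g by (simp add: excess_add L1_norm_diff_le)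
  show "L1_norm h \<le> L1_norm f + (excess f h + excess h f)"
    using L1_norm_diff_triangle[OF h _ f, of "\<lambda>_. 0"] excess_add[OF h f] by simp
  show "L1_norm h \<le> L1_norm g + (excess h g + excess g h)"
    using L1_norm_diff_triangle[OF h _ g, of "\<lambda>_. 0"] excess_add[OF h g] by simp
qed (simp_all add: excess_nonneg L1_norm_nonneg)

theorem theorem3p6:
  fixes p :: ereal
  assumes "1 \<le> p"
  shows "Metric_space (UNIV :: L_space set) (L_dist_N p) \<and>
    (\<forall>f g :: L_space. L_dist_N p f g \<in> {0..1})"
proof (intro conjI Metric_space.intro allI)
  fix f g h :: L_space
  show nonneg: "0 \<le> L_dist_N p f g" for f g
    by transfer (auto simp: ae_eq_def intro: dist_N_nonneg)
  show "L_dist_N p f g = L_dist_N p g f"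
    by transfer (auto simp: ae_eq_def intro: dist_N_commute)
  \<comment> \<open>Equality of classes transfers to \<open>ae_eq\<close> of
    representatives.\<close>
  show "L_dist_N p f g = 0 \<longleftrightarrow> f = g"
    using assms by transfer (auto simp: ae_eq_def dist_N_eq_0_iff)
  show "L_dist_N p f h \<le> L_dist_N p f g + L_dist_N p g h"
    using assms by transfer (auto simp: ae_eq_def intro: dist_N_triangle)
  have "L_dist_N p f g \<le> 1"
    using assms by transfer (auto simp: ae_eq_def intro: dist_N_le_1)
  with nonneg show "L_dist_N p f g \<in> {0..1}" by simp
qed

end
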